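(* Let $G$ be a finite directed graph with $m$ vertices and $n$ edges, let $M$ be its $m\times m$ transition matrix, and let $N$ be the $n\times n$ matrix of $0$'s and $1$'s which is the transition matrix of the edge graph $H$ of $G$. If $p(t)=\det(tI-M)$ is the characteristic polynomial of $M$, then the characteristic polynomial $q(t)=\det(tI-N)$ of $N$ is $q(t)=t^{\,n-m}\,p(t)$.
   Context: Directed graphs may have loops and multiple edges. The transition matrix of a directed graph with vertices $v_1,\dots,v_m$ is the matrix $M=[m_{i,j}]$ of nonnegative integers where $m_{i,j}$ is the number of edges directed from $v_i$ to $v_j$; every square nonnegative integer matrix arises in this way. Edge graph $H$ of $G$: label the edges of $G$ as $e_1,\dots,e_n$. The vertices $w_1,\dots,w_n$ of $H$ are in one-to-one correspondence with the edges of $G$ ($w_i\leftrightarrow e_i$), and there is exactly one edge in $H$ from $w_i$ to $w_j$ if $e_i$ terminates at the vertex from which $e_j$ emanates, and none otherwise. The identity $q(t)=t^{n-m}p(t)$ is read in $\mathbb{Z}[t,t^{-1}]$. *)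

theory Defs
  imports
    "Graph_Theory.Digraph"
    "Jordan_Normal_Form.Char_Poly"
    "HOL-Library.Poly_Mapping"
begin

text \<open>
  The list \<open>vs\<close> is the labelling of the vertices: it is meant to
  enumerate \<^term>\<open>verts G\<close> without repetition, with indices shifted to start at 0.
\<close>

definition transition_mat :: "('a, 'b) pre_digraph \<Rightarrow> 'a list \<Rightarrow> int mat" where
  "transition_mat G vs = mat (length vs) (length vs)
     (\<lambda>(i, j). int (card {e \<in> arcs G. tail G e = vs ! i \<and> head G e = vs ! j}))"

definition edge_graph :: "('a, 'b) pre_digraph \<Rightarrow> ('b, 'b \<times> 'b) pre_digraph" where
  "edge_graph G =
     \<lparr> verts = arcs G,
       arcs = {(e, f). e \<in> arcs G \<and> f \<in> arcs G \<and> head G e = tail G f},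
       tail = fst,
       head = snd \<rparr>"

lemma fin_digraph_edge_graph:
  assumes "fin_digraph G"
  shows "fin_digraph (edge_graph G)"
proof -
  interpret fin_digraph G by fact
  have "finite {(e, f). e \<in> arcs G \<and> f \<in> arcs G \<and> head G e = tail G f}"
    by (rule finite_subset[of _ "arcs G \<times> arcs G"]) auto
  then show ?thesis
    by unfold_locales (auto simp: edge_graph_def)
qed

lemma transition_mat_edge_graph:
  assumes "set es = arcs G"
  shows "transition_mat (edge_graph G) es = mat (length es) (length es)
    (\<lambda>(i, j). if head G (es ! i) = tail G (es ! j) then 1 else 0)"
proof -
  have "{a \<in> arcs (edge_graph G). tail (edge_graph G) a = e \<and> head (edge_graph G) a = f}
      = (if head G e = tail G f then {(e, f)} else {})"
    if "e \<in> arcs G" "f \<in> arcs G" for e f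
    using that by (auto simp: edge_graph_def)
  then have "int (card {a \<in> arcs (edge_graph G).
        tail (edge_graph G) a = e \<and> head (edge_graph G) a = f})
      = (if head G e = tail G f then 1 else 0)"
    if "e \<in> arcs G" "f \<in> arcs G" for e f
    using that by simp
  moreover have "es ! i \<in> arcs G" if "i < length es" for i
    using that assms nth_mem by metis
  ultimately show ?thesis
    unfolding transition_mat_def by (intro cong_mat) auto
qed

text \<open>
  The Laurent polynomial ring \<open>\<int>[t, t\<^sup>-\<^sup>1]\<close> is the group ring of \<open>(\<int>, +)\<close> over \<open>\<int>\<close>,
  that is, the type \<^typ>\<open>int \<Rightarrow>\<^sub>0 int\<close> of finitely supported functions with the convolution
  product; the monomial \<open>c t\<^sup>k\<close> is \<^term>\<open>Poly_Mapping.single k c\<close>.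
\<close>

type_synonym int_laurent = "int \<Rightarrow>\<^sub>0 int"

definition laurent_monom :: "int \<Rightarrow> int_laurent" where
  "laurent_monom k = Poly_Mapping.single k 1"

definition laurent_of_poly :: "int poly \<Rightarrow> int_laurent" where
  "laurent_of_poly p = (\<Sum>i\<le>degree p. Poly_Mapping.single (int i) (coeff p i))"

lemma lookup_laurent_of_poly:
  "Poly_Mapping.lookup (laurent_of_poly p) k = (if k < 0 then 0 else coeff p (nat k))"
proof -
  have "Poly_Mapping.lookup (laurent_of_poly p) k
      = (\<Sum>i\<le>degree p. if int i = k then coeff p i else 0)"
    by (simp add: laurent_of_poly_def lookup_sum lookup_single when_def)
  also have "\<dots> = (if k < 0 then 0 else coeff p (nat k))"
  proof (cases "k < 0")
    case True
    then show ?thesis by (intro trans[OF sum.neutral]) auto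
  next
    case False
    then have "int i = k \<longleftrightarrow> i = nat k" for i by auto
    with False show ?thesis
      by (simp add: coeff_eq_0)
  qed
  finally show ?thesis .
qed

lemma inj_laurent_of_poly: "inj laurent_of_poly"
proof (rule injI, rule poly_eqI)
  fix p q n
  assume "laurent_of_poly p = laurent_of_poly q"
  then show "coeff p n = coeff q n"
    using lookup_laurent_of_poly[of p "int n"] lookup_laurent_of_poly[of q "int n"] by simp
qed

end

theory Submission
  imports Defs
begin

text \<open>
  Let \<open>A\<close> be the vertex-edge incidence matrix of the tails and \<open>B\<close> the edge-vertex incidence
  matrix of the heads. Then \<open>M = A B\<close> and \<open>N = B A\<close>, so the theorem is an instance of
  \<open>t\<^sup>n det (t I - A B) = t\<^sup>m det (t I - B A)\<close> (Sylvester).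
\<close>

text \<open>
  Both sides are computed from the block matrix with rows \<open>(x I, A)\<close> and \<open>(B, I)\<close>: multiplying it
  on the right by \<open>((I, 0), (-B, I))\<close> gives \<open>((x I - A B, A), (0, I))\<close>, multiplying it on the left
  by \<open>((I, 0), (-B, x I))\<close> gives \<open>((x I, A), (0, x I - B A))\<close>.
\<close>

lemma det_smult_one_minus_mult_commute:
  fixes A B :: "'a :: idom mat"
  assumes A: "A \<in> carrier_mat m n" and B: "B \<in> carrier_mat n m"
  shows "x ^ n * det (x \<cdot>\<^sub>m 1\<^sub>m m - A * B) = x ^ m * det (x \<cdot>\<^sub>m 1\<^sub>m n - B * A)"
proof -
  let ?K = "four_block_mat (x \<cdot>\<^sub>m 1\<^sub>m m) A B (1\<^sub>m n)"
  let ?R = "four_block_mat (1\<^sub>m m) (0\<^sub>m m n) (- B) (1\<^sub>m n)"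
  let ?L = "four_block_mat (1\<^sub>m m) (0\<^sub>m m n) (- B) (x \<cdot>\<^sub>m 1\<^sub>m n)"
  have K: "?K \<in> carrier_mat (m + n) (m + n)" and R: "?R \<in> carrier_mat (m + n) (m + n)"
    and L: "?L \<in> carrier_mat (m + n) (m + n)"
    using A B by auto
  have AB: "A * B \<in> carrier_mat m m" and BA: "B * A \<in> carrier_mat n n"
    using A B by auto
  have KR: "?K * ?R = four_block_mat (x \<cdot>\<^sub>m 1\<^sub>m m - A * B) A (0\<^sub>m n m) (1\<^sub>m n)"
  proof (subst mult_four_block_mat)
    show "four_block_mat (x \<cdot>\<^sub>m 1\<^sub>m m * 1\<^sub>m m + A * - B) (x \<cdot>\<^sub>m 1\<^sub>m m * 0\<^sub>m m n + A * 1\<^sub>m n)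
        (B * 1\<^sub>m m + 1\<^sub>m n * - B) (B * 0\<^sub>m m n + 1\<^sub>m n * 1\<^sub>m n) =
      four_block_mat (x \<cdot>\<^sub>m 1\<^sub>m m - A * B) A (0\<^sub>m n m) (1\<^sub>m n)"
      by (intro arg_cong4[where f = four_block_mat] eq_matI)
        (use A B AB in auto)
  qed (use A B in auto)
  have LK: "?L * ?K = four_block_mat (x \<cdot>\<^sub>m 1\<^sub>m m) A (0\<^sub>m n m) (x \<cdot>\<^sub>m 1\<^sub>m n - B * A)"
  proof (subst mult_four_block_mat)
    \<comment> \<open>Once the scalar is pulled out of both products, the lower left block is a
      matrix plus its negative and vanishes entrywise.\<close>
    have *: "- B * (x \<cdot>\<^sub>m 1\<^sub>m m) = x \<cdot>\<^sub>m (- B)" "x \<cdot>\<^sub>m 1\<^sub>m n * B = x \<cdot>\<^sub>m B"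
      "- B * A = - (B * A)"
      using A B mult_smult_distrib[of "- B" n m "1\<^sub>m m" m x]
        mult_smult_assoc_mat[of "1\<^sub>m n" n n B m x] by auto
    show "four_block_mat (1\<^sub>m m * (x \<cdot>\<^sub>m 1\<^sub>m m) + 0\<^sub>m m n * B) (1\<^sub>m m * A + 0\<^sub>m m n * 1\<^sub>m n)
        (- B * (x \<cdot>\<^sub>m 1\<^sub>m m) + x \<cdot>\<^sub>m 1\<^sub>m n * B) (- B * A + x \<cdot>\<^sub>m 1\<^sub>m n * 1\<^sub>m n) =
      four_block_mat (x \<cdot>\<^sub>m 1\<^sub>m m) A (0\<^sub>m n m) (x \<cdot>\<^sub>m 1\<^sub>m n - B * A)"
      unfolding *
      by (intro arg_cong4[where f = four_block_mat] eq_matI)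
        (use A B BA in auto)
  qed (use A B in auto)
  have "det ?K * det ?R = det (x \<cdot>\<^sub>m 1\<^sub>m m - A * B)"
    unfolding det_mult[OF K R, symmetric] KR
    by (subst det_four_block_mat_lower_left_zero[of _ m _ n]) (use A B in auto)
  moreover have "det ?L * det ?K = x ^ m * det (x \<cdot>\<^sub>m 1\<^sub>m n - B * A)"
    unfolding det_mult[OF L K, symmetric] LK
    by (subst det_four_block_mat_lower_left_zero[of _ m _ n]) (use A B in auto)
  moreover have "det ?R = 1"
    by (subst det_four_block_mat_upper_right_zero[of _ m _ n]) (use B in auto)
  moreover have "det ?L = x ^ n"
    by (subst det_four_block_mat_upper_right_zero[of _ m _ n]) (use B in auto)
  \<comment> \<open>Both determinants are expressed through \<open>det ?K\<close>, which is
    eliminated by multiplication alone, so \<open>x\<close> need not be invertible.\<close>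
  ultimately show ?thesis
    by simp
qed

text \<open>This is the determinant identity over the polynomial ring, with \<open>x\<close> the
  indeterminate \<open>[:0, 1:]\<close> and the entries of \<open>A\<close> and \<open>B\<close>
  embedded as constants.\<close>

lemma char_poly_mult_commute:
  fixes A B :: "'a :: idom mat"
  assumes A: "A \<in> carrier_mat m n" and B: "B \<in> carrier_mat n m"
  shows "monom 1 n * char_poly (A * B) = monom 1 m * char_poly (B * A)"
proof -
  let ?c = "map_mat (\<lambda>a :: 'a. [:a:])"
  \<comment> \<open>The constant embedding is a ring homomorphism, so it distributes over the matrix
    product and exposes the factors.\<close>
  have *: "char_poly (C * D) = det ([:0, 1:] \<cdot>\<^sub>m 1\<^sub>m k - ?c C * ?c D)"
    if "C \<in> carrier_mat k l" "D \<in> carrier_mat l k" for C D :: "'a mat" and k l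
  proof -
    have "?c C * ?c D = ?c (C * D)"
      using that by (simp add: map_poly_mult)
    moreover have "char_poly_matrix (C * D) = [:0, 1:] \<cdot>\<^sub>m 1\<^sub>m k - ?c (C * D)"
      using that by (intro eq_matI) (auto simp: char_poly_matrix_def)
    ultimately show ?thesis
      by (simp add: char_poly_def)
  qed
  have "?c A \<in> carrier_mat m n" "?c B \<in> carrier_mat n m"
    using A B by auto
  from det_smult_one_minus_mult_commute[OF this, of "[:0, 1:]"] show ?thesis
    unfolding *[OF A B] *[OF B A] monom_altdef smult_1_left .
qed

definition tail_incidence :: "('a, 'b) pre_digraph \<Rightarrow> 'a list \<Rightarrow> 'b list \<Rightarrow> int mat" where
  "tail_incidence G vs es = mat (length vs) (length es)
     (\<lambda>(i, k). of_bool (tail G (es ! k) = vs ! i))"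

definition head_incidence :: "('a, 'b) pre_digraph \<Rightarrow> 'a list \<Rightarrow> 'b list \<Rightarrow> int mat" where
  "head_incidence G vs es = mat (length es) (length vs)
     (\<lambda>(k, j). of_bool (head G (es ! k) = vs ! j))"

lemma incidence_carrier [simp]:
  "tail_incidence G vs es \<in> carrier_mat (length vs) (length es)"
  "head_incidence G vs es \<in> carrier_mat (length es) (length vs)"
  by (simp_all add: tail_incidence_def head_incidence_def)

lemma sum_nth_distinct:
  assumes "distinct xs"
  shows "(\<Sum>k<length xs. f (xs ! k)) = (\<Sum>x\<in>set xs. f x)"
  by (rule sum.reindex_bij_betw[OF bij_betw_nth]) (use assms in auto)

text \<open>In the \<open>(i, j)\<close> entry of the product, an edge contributes 1 exactly if it
  runs from \<open>vs ! i\<close> to \<open>vs ! j\<close>; distinctness of \<open>es\<close>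
  ensures that it is counted once.\<close>

lemma transition_mat_conv_incidence:
  assumes "distinct es" and "set es = arcs G"
  shows "transition_mat G vs = tail_incidence G vs es * head_incidence G vs es"
proof (rule eq_matI)
  fix i j
  assume "i < dim_row (tail_incidence G vs es * head_incidence G vs es)"
    and "j < dim_col (tail_incidence G vs es * head_incidence G vs es)"
  then have ij: "i < length vs" "j < length vs"
    by (auto simp: tail_incidence_def head_incidence_def)
  have "finite (arcs G)"
    using assms(2) by (metis List.finite_set)
  have "(tail_incidence G vs es * head_incidence G vs es) $$ (i, j) =
      (\<Sum>k<length es. of_bool (tail G (es ! k) = vs ! i \<and> head G (es ! k) = vs ! j))"
    unfolding of_bool_conj using ij
    by (simp add: tail_incidence_def head_incidence_def scalar_prod_def atLeast0LessThan)
  also have "\<dots> = (\<Sum>e\<in>arcs G. of_bool (tail G e = vs ! i \<and> head G e = vs ! j))"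
    unfolding assms(2)[symmetric] by (rule sum_nth_distinct[OF assms(1)])
  also have "\<dots> = int (card {e \<in> arcs G. tail G e = vs ! i \<and> head G e = vs ! j})"
    using \<open>finite (arcs G)\<close> by (simp add: sum_of_bool_eq Int_def)
  finally show "transition_mat G vs $$ (i, j) =
      (tail_incidence G vs es * head_incidence G vs es) $$ (i, j)"
    using ij by (simp add: transition_mat_def)
qed (auto simp: transition_mat_def tail_incidence_def head_incidence_def)

text \<open>The product counts the vertices that are both the head of one edge and the tail of the
  other. There is at most one, and well-formedness puts the head among the vertices summed
  over.\<close>

lemma transition_mat_edge_graph_conv_incidence:
  assumes "wf_digraph G" and "distinct vs" and "set vs = verts G" and "set es = arcs G"
  shows "transition_mat (edge_graph G) es = head_incidence G vs es * tail_incidence G vs es"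
proof (rule eq_matI)
  interpret wf_digraph G by fact
  fix i j
  assume "i < dim_row (head_incidence G vs es * tail_incidence G vs es)"
    and "j < dim_col (head_incidence G vs es * tail_incidence G vs es)"
  then have ij: "i < length es" "j < length es"
    by (auto simp: tail_incidence_def head_incidence_def)
  then have "head G (es ! i) \<in> verts G"
    using assms(4) by (metis nth_mem head_in_verts)
  have "finite (verts G)"
    using assms(3) by (metis List.finite_set)
  have "(head_incidence G vs es * tail_incidence G vs es) $$ (i, j) =
      (\<Sum>k<length vs. of_bool (head G (es ! i) = vs ! k \<and> tail G (es ! j) = vs ! k))"
    unfolding of_bool_conj using ij
    by (simp add: tail_incidence_def head_incidence_def scalar_prod_def atLeast0LessThan)
  also have "\<dots> = (\<Sum>v\<in>verts G. of_bool (head G (es ! i) = v \<and> tail G (es ! j) = v))"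
    unfolding assms(3)[symmetric] by (rule sum_nth_distinct[OF assms(2)])
  also have "\<dots> = (\<Sum>v\<in>verts G. if v = head G (es ! i)
      then of_bool (head G (es ! i) = tail G (es ! j)) else 0)"
    by (intro sum.cong) auto
  also have "\<dots> = of_bool (head G (es ! i) = tail G (es ! j))"
    using \<open>finite (verts G)\<close> \<open>head G (es ! i) \<in> verts G\<close> by simp
  finally show "transition_mat (edge_graph G) es $$ (i, j) =
      (head_incidence G vs es * tail_incidence G vs es) $$ (i, j)"
    using ij by (simp add: transition_mat_edge_graph[OF assms(4)])
qed (auto simp: transition_mat_def tail_incidence_def head_incidence_def)

lemma laurent_of_poly_add:
  "laurent_of_poly (p + q) = laurent_of_poly p + laurent_of_poly q"
  by (rule poly_mapping_eqI) (simp add: lookup_laurent_of_poly lookup_add)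

text \<open>Expanding \<open>p\<close> into monomials reduces this to a shift of exponents. It is
  the only multiplicativity of the embedding into Laurent polynomials that the theorem uses.\<close>

lemma laurent_of_poly_monom_mult:
  "laurent_of_poly (monom 1 n * p) = laurent_monom (int n) * laurent_of_poly p"
proof -
  have 1: "laurent_of_poly (monom c k) = Poly_Mapping.single (int k) c" for c k
    by (rule poly_mapping_eqI) (auto simp: lookup_laurent_of_poly lookup_single when_def)
  have sum: "laurent_of_poly (\<Sum>i\<in>I. f i) = (\<Sum>i\<in>I. laurent_of_poly (f i))" for f and I :: "nat set"
    by (induction I rule: infinite_finite_induct)
      \<comment> \<open>Empty and infinite \<open>I\<close> leave
        \<open>laurent_of_poly 0 = 0\<close>, which holds by definition.\<close>
      (simp_all add: laurent_of_poly_add, simp_all add: laurent_of_poly_def)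
  have "laurent_of_poly (monom 1 n * p)
      = laurent_of_poly (\<Sum>i\<le>degree p. monom (coeff p i) (n + i))"
    by (subst poly_as_sum_of_monoms[of p, symmetric]) (simp add: sum_distrib_left mult_monom)
  also have "\<dots> = laurent_monom (int n) * laurent_of_poly p"
    by (simp add: sum 1 laurent_of_poly_def[of p] laurent_monom_def sum_distrib_left mult_single)
  finally show ?thesis .
qed

lemma laurent_monom_mult: "laurent_monom j * laurent_monom k = laurent_monom (j + k)"
  by (simp add: laurent_monom_def mult_single)

theorem theorem14:
  fixes G :: "('a, 'b) pre_digraph" and vs :: "'a list" and es :: "'b list"
    and m n :: nat and M N :: "int mat" and p q :: "int poly"
  assumes "fin_digraph G"
    and "distinct vs" and "set vs = verts G" and "m = card (verts G)"
    and "distinct es" and "set es = arcs G" and "n = card (arcs G)"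
    and "M = transition_mat G vs"
    and "N = transition_mat (edge_graph G) es"
    and "p = char_poly M"
    and "q = char_poly N"
  shows "laurent_of_poly q = laurent_monom (int n - int m) * laurent_of_poly p"
proof -
  interpret fin_digraph G by fact
  have len: "length vs = m" "length es = n"
    using assms(2-7) distinct_card by metis+
  \<comment> \<open>Since \<open>n - m\<close> may be negative, the identity is first stated in the
    polynomial ring without division.\<close>
  have "monom 1 n * p = monom 1 m * q"
    unfolding assms(8-11) transition_mat_conv_incidence[OF assms(5,6)]
      transition_mat_edge_graph_conv_incidence[OF wf_digraph_axioms assms(2,3,6)]
    by (rule char_poly_mult_commute) (simp_all flip: len)
  then have eq: "laurent_monom (int m) * laurent_of_poly q
      = laurent_monom (int n) * laurent_of_poly p"
    by (simp flip: laurent_of_poly_monom_mult)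
  \<comment> \<open>In the Laurent ring the monomial of exponent \<open>m\<close> is a unit, so it
    can be cancelled by its inverse.\<close>
  have "laurent_of_poly q
      = laurent_monom (- int m) * (laurent_monom (int m) * laurent_of_poly q)"
    by (simp add: laurent_monom_mult flip: mult.assoc) (simp add: laurent_monom_def)
  also have "\<dots> = laurent_monom (int n - int m) * laurent_of_poly p"
    unfolding eq by (simp add: laurent_monom_mult flip: mult.assoc)
  finally show ?thesis .
qed

end
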